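(* Let $S$ be a connected surface with boundary whose interior $\mathrm{int}(S)=S-\partial S$ is metrizable. Then at most countably many connected components of $\partial S$ are circles (i.e. homeomorphic to $\mathbb{S}^1$).
   Context: A surface with boundary is a Hausdorff space in which every point has an open neighborhood homeomorphic to $\mathbb{R}^2$ or to $\mathbb{R}\times\mathbb{R}_{\ge 0}$ (no metrizability or second countability is assumed). $\partial S$ denotes the manifold boundary. *)

theory Defs
  imports "HOL-Analysis.Analysis"
begin

text \<open>No countability or metrizability condition is imposed on surfaces, and the empty space
  is not excluded.\<close>

definition surface_with_boundary :: "'a topology \<Rightarrow> bool" where
  "surface_with_boundary S \<longleftrightarrow>
     Hausdorff_space S \<and>
     (\<forall>x\<in>topspace S. \<exists>U. openin S U \<and> x \<in> U \<and>
        (subtopology S U homeomorphic_space (euclidean :: (real \<times> real) topology) \<or>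
         subtopology S U homeomorphic_space
           top_of_set ((UNIV :: real set) \<times> {0 :: real ..})))"

text \<open>The manifold boundary, as opposed to the topological boundary \<^const>\<open>frontier_of\<close> of a
  subset of a space: the points of \<open>S\<close> without a Euclidean neighborhood.\<close>

definition surface_boundary :: "'a topology \<Rightarrow> 'a set" where
  "surface_boundary S =
     {x \<in> topspace S. \<not> (\<exists>U. openin S U \<and> x \<in> U \<and>
        subtopology S U homeomorphic_space (euclidean :: (real \<times> real) topology))}"

definition surface_interior :: "'a topology \<Rightarrow> 'a set" where
  "surface_interior S = topspace S - surface_boundary S"

end

theory Submission imports Defs begin

text \<open>Circles are compact, and a connected surface with metrizable interior \<open>M\<close> has at most countably many compact boundary components
  (\<open>countable_compact_boundary_components\<close>). (Noncompact ones can be uncountable in number, as in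
  the Pruefer surface.)

  Half-plane charts show that \<open>M\<close> is dense and connected, so \<open>M\<close> is a connected, locally compact
  metrizable space and therefore second countable. Consequently \<open>M\<close> has a countable dense set \<open>D\<close>
  and a countable family \<open>\<K>\<close> of compact sets such that every compact subset of \<open>M\<close> lies in a
  member of \<open>\<K>\<close>.

  A boundary component \<open>C\<close> is open in \<open>\<partial>S\<close>. If \<open>C\<close> is compact, it has a compact neighborhood \<open>L\<close>
  with \<open>L \<inter> \<partial>S = C\<close>, whose outer rim is a compact subset of \<open>M\<close> and hence lies in some \<open>K \<in> \<K>\<close>.
  A connected set that contains \<open>C\<close> and avoids the rim cannot leave \<open>L\<close>, so the component of
  \<open>S - K\<close> around \<open>C\<close> meets \<open>\<partial>S\<close> in \<open>C\<close> alone. That component is open, because \<open>S\<close> is locally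
  connected, so it contains a point \<open>d \<in> D\<close>. Thus \<open>C\<close> can be recovered from the pair \<open>(K, d)\<close>,
  and there are only countably many such pairs.\<close>

section \<open>Connected locally compact metrizable spaces are second countable\<close>

lemma (in Metric_space) compactin_imp_separable:
  assumes "compactin mtopology K"
  shows "\<exists>N. countable N \<and> N \<subseteq> K \<and> K \<subseteq> mtopology closure_of N"
proof -
  have "\<forall>n. \<exists>F. finite F \<and> F \<subseteq> K \<and> K \<subseteq> (\<Union>x\<in>F. mball x (inverse (real (Suc n))))"
    using compactin_imp_mtotally_bounded[OF assms] unfolding mtotally_bounded_def
    by (metis inverse_positive_iff_positive of_nat_0_less_iff zero_less_Suc)
  then obtain F where F: "\<And>n. finite (F n)" "\<And>n. F n \<subseteq> K"
    "\<And>n. K \<subseteq> (\<Union>x\<in>F n. mball x (inverse (real (Suc n))))"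
    by metis
  have "K \<subseteq> mtopology closure_of (\<Union>n. F n)"
  proof
    fix y assume y: "y \<in> K"
    then have "y \<in> M"
      using assms compactin_subset_topspace by fastforce
    moreover have "\<exists>x\<in>(\<Union>n. F n). x \<in> mball y r" if "r > 0" for r
    proof -
      obtain n where "inverse (real (Suc n)) < r"
        using \<open>r > 0\<close> reals_Archimedean by blast
      moreover obtain x where "x \<in> F n" "y \<in> mball x (inverse (real (Suc n)))"
        using F(3)[of n] y by blast
      ultimately show ?thesis
        by (intro bexI[of _ x]) (auto simp: commute)
    qed
    ultimately show "y \<in> mtopology closure_of (\<Union>n. F n)"
      unfolding metric_closure_of by blast
  qed
  moreover have "countable (\<Union>n. F n)"
    using F(1) by (simp add: countable_finite)
  ultimately show ?thesis
    using F(2) by blast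
qed

lemma (in Metric_space) locally_compact_small_mcball:
  assumes "locally_compact_space mtopology" and "x \<in> M"
  obtains r where "r > 0" "compactin mtopology (mcball x r)"
proof -
  obtain U K where UK: "openin mtopology U" "compactin mtopology K" "x \<in> U" "U \<subseteq> K"
    using assms unfolding locally_compact_space_def by fastforce
  then obtain r where "r > 0" "mcball x r \<subseteq> U"
    unfolding openin_mtopology_mcball by blast
  with UK have "compactin mtopology (mcball x r)"
    by (meson closed_compactin closedin_mcball order.trans)
  with \<open>r > 0\<close> show thesis
    using that by blast
qed

text \<open>Starting from one point, enlarge a countable set repeatedly by countable dense subsets of all
  compact closed balls with center in the set and rational radius. The closure of the resulting
  countable set \<open>D\<close> is open: if the closed ball of radius \<open>r\<close> around a limit point \<open>y\<close> is compact,
  then some \<open>x \<in> D\<close> close to \<open>y\<close> has a compact rational ball inside it that still contains a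
  neighborhood of \<open>y\<close>. Connectedness does the rest.\<close>

lemma (in Metric_space) connected_locally_compact_imp_separable:
  assumes conn: "connected_space mtopology" and loc: "locally_compact_space mtopology"
  shows "\<exists>D. countable D \<and> D \<subseteq> M \<and> mtopology closure_of D = M"
proof (cases "M = {}")
  case True
  then show ?thesis
    by (intro exI[of _ "{}"]) auto
next
  case False
  then obtain a where a: "a \<in> M"
    by blast
  define I where "I D = {(x,q). x \<in> D \<and> q \<in> \<rat> \<and> compactin mtopology (mcball x q)}" for D
  define B where "B D = (\<Union>(x,q)\<in>I D. mcball x q)" for D
  have "\<exists>E. countable E \<and> E \<subseteq> M \<and> B D \<subseteq> mtopology closure_of E" if "countable D" for D
  proof -
    have "\<forall>p\<in>I D. \<exists>N. countable N \<and> N \<subseteq> M \<and> mcball (fst p) (snd p) \<subseteq> mtopology closure_of N"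
      using compactin_imp_separable compactin_subset_topspace unfolding I_def by fastforce
    then obtain N where N: "\<And>p. p \<in> I D \<Longrightarrow> countable (N p) \<and> N p \<subseteq> M \<and>
        mcball (fst p) (snd p) \<subseteq> mtopology closure_of N p"
      by metis
    have "I D \<subseteq> D \<times> \<rat>"
      unfolding I_def by auto
    with that have "countable (I D)"
      by (meson countable_SIGMA countable_rat countable_subset)
    with N have "countable (\<Union>p\<in>I D. N p)"
      by blast
    moreover have "B D \<subseteq> mtopology closure_of (\<Union>p\<in>I D. N p)"
    proof -
      have "mcball (fst p) (snd p) \<subseteq> mtopology closure_of (\<Union>p\<in>I D. N p)" if "p \<in> I D" for p
        using N[OF that] closure_of_mono[of "N p" "\<Union>p\<in>I D. N p" mtopology] that by blast
      then show ?thesis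
        unfolding B_def by fastforce
    qed
    ultimately show ?thesis
      using N by (intro exI[of _ "\<Union>p\<in>I D. N p"]) blast
  qed
  then obtain T where T: "\<And>D. countable D \<Longrightarrow> countable (T D) \<and> T D \<subseteq> M \<and> B D \<subseteq> mtopology closure_of (T D)"
    by metis
  define A where "A n = (T ^^ n) {a}" for n
  have A: "countable (A n) \<and> A n \<subseteq> M" for n
    unfolding A_def by (induction n) (use a T in auto)
  define D where "D = (\<Union>n. A n)"
  have D: "countable D" "D \<subseteq> M"
    using A unfolding D_def by blast+
  have BD: "B D \<subseteq> mtopology closure_of D"
  proof
    fix y assume "y \<in> B D"
    then obtain x q where xq: "x \<in> D" "(x,q) \<in> I D" "y \<in> mcball x q"
      unfolding B_def I_def by auto
    then obtain n where "x \<in> A n"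
      unfolding D_def by blast
    with xq have "y \<in> B (A n)"
      unfolding B_def I_def by blast
    then have "y \<in> mtopology closure_of (A (Suc n))"
      using T[of "A n"] A[of n] unfolding A_def by auto
    then show "y \<in> mtopology closure_of D"
      using closure_of_mono[of "A (Suc n)" D mtopology] unfolding D_def by blast
  qed
  have "openin mtopology (mtopology closure_of D)"
    unfolding openin_mtopology
  proof (intro conjI allI impI)
    show "mtopology closure_of D \<subseteq> M"
      using closure_of_subset_topspace by fastforce
  next
    fix y assume y: "y \<in> mtopology closure_of D"
    then have yM: "y \<in> M"
      using closure_of_subset_topspace by fastforce
    then obtain r where r: "r > 0" "compactin mtopology (mcball y r)"
      using locally_compact_small_mcball[OF loc] by blast
    \<comment> \<open>For \<open>x\<close> within \<open>r/3\<close> of \<open>y\<close>, a radius above \<open>r/3\<close> makes the ball around \<open>x\<close> a neighborhood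
      of \<open>y\<close>, and a radius below \<open>2r/3\<close> keeps it inside the compact ball.\<close>
    obtain q where q: "q \<in> \<rat>" "r/3 < q" "q < 2*r/3"
      using Rats_dense_in_real[of "r/3" "2*r/3"] r by auto
    have "\<exists>x\<in>D. x \<in> mball y (r/3)"
      using y r(1) unfolding metric_closure_of by (auto elim!: allE[of _ "r/3"])
    then obtain x where x: "x \<in> D" "x \<in> mball y (r/3)"
      by blast
    have "mcball x q \<subseteq> mcball y r"
      using x q yM by (intro mcball_subset) (auto simp: commute)
    then have "compactin mtopology (mcball x q)"
      using r closed_compactin closedin_mcball by blast
    then have "mcball x q \<subseteq> B D"
      using x q unfolding B_def I_def by blast
    moreover have "mball y (q - r/3) \<subseteq> mcball x q"
      using x by (intro order_trans[OF mball_subset mball_subset_mcball]) auto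
    ultimately show "\<exists>s>0. mball y s \<subseteq> mtopology closure_of D"
      using BD q by (intro exI[of _ "q - r/3"]) auto
  qed
  moreover have "a \<in> mtopology closure_of D"
  proof -
    have "a \<in> D"
      unfolding D_def A_def by (auto intro!: exI[of _ 0])
    then show ?thesis
      using D closure_of_subset[of D mtopology] by auto
  qed
  ultimately have "mtopology closure_of D = M"
    using conn closedin_closure_of[of mtopology D] unfolding connected_space_clopen_in by fastforce
  with D show ?thesis
    by blast
qed

lemma (in Metric_space) separable_imp_second_countable:
  assumes "countable D" and dense: "mtopology closure_of D = M"
  shows "second_countable mtopology"
  unfolding second_countable_def
proof (intro exI[of _ "(\<lambda>(x,q). mball x q) ` (D \<times> \<rat>)"] conjI ballI allI impI)
  show "countable ((\<lambda>(x,q). mball x q) ` (D \<times> \<rat>))"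
    using assms countable_rat by blast
next
  fix U y assume "openin mtopology U \<and> y \<in> U"
  then obtain r where r: "r > 0" "mball y r \<subseteq> U" and y: "y \<in> M"
    unfolding openin_mtopology by blast
  obtain q where q: "q \<in> \<rat>" "r/3 < q" "q < 2*r/3"
    using Rats_dense_in_real[of "r/3" "2*r/3"] r by auto
  have "y \<in> mtopology closure_of D"
    using y dense by simp
  then have "\<exists>x\<in>D. x \<in> mball y (r/3)"
    using r(1) unfolding metric_closure_of by (auto elim!: allE[of _ "r/3"])
  then obtain x where x: "x \<in> D" "x \<in> mball y (r/3)"
    by blast
  have "mball x q \<subseteq> mball y r"
    using x q y by (intro mball_subset) (auto simp: commute)
  moreover have "y \<in> mball x q"
    using x q y by (auto simp: commute)
  ultimately show "\<exists>V\<in>(\<lambda>(x,q). mball x q) ` (D \<times> \<rat>). y \<in> V \<and> V \<subseteq> U"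
    using x q r by blast
qed auto

theorem connected_locally_compact_metrizable_imp_second_countable:
  assumes "metrizable_space X" "connected_space X" "locally_compact_space X"
  shows "second_countable X"
proof -
  obtain M d where "Metric_space M d" and X: "X = Metric_space.mtopology M d"
    using assms(1) unfolding metrizable_space_def by blast
  then interpret Metric_space M d
    by blast
  obtain D where "countable D" "mtopology closure_of D = M"
    using connected_locally_compact_imp_separable assms(2,3) unfolding X by auto
  then show ?thesis
    unfolding X by (rule separable_imp_second_countable)
qed

text \<open>Spaces with such a family are called hemicompact. The members of \<open>\<K>\<close> are the finite unions of
  compact neighborhoods taken from a countable subcover.\<close>

lemma Lindelof_locally_compact_imp_hemicompact:
  assumes "Lindelof_space X" and loc: "locally_compact_space X"
  obtains \<K> where "countable \<K>" "\<And>K. K \<in> \<K> \<Longrightarrow> compactin X K"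
    "\<And>F. compactin X F \<Longrightarrow> \<exists>K\<in>\<K>. F \<subseteq> K"
proof -
  obtain U L where UL: "\<And>x. x \<in> topspace X \<Longrightarrow> openin X (U x) \<and> compactin X (L x) \<and> x \<in> U x \<and> U x \<subseteq> L x"
    using loc unfolding locally_compact_space_def by metis
  have "\<exists>\<V>. countable \<V> \<and> \<V> \<subseteq> U ` topspace X \<and> \<Union>\<V> = topspace X"
    using UL openin_subset by (intro Lindelof_spaceD[OF assms(1)]) blast+
  then obtain P where P: "countable P" "P \<subseteq> topspace X" "(\<Union>x\<in>P. U x) = topspace X"
    by (metis countable_subset_image)
  show thesis
  proof
    show "countable ((\<lambda>Q. \<Union>x\<in>Q. L x) ` {Q. finite Q \<and> Q \<subseteq> P})"
      using P(1) countable_Collect_finite_subset by blast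
  next
    fix K assume "K \<in> (\<lambda>Q. \<Union>x\<in>Q. L x) ` {Q. finite Q \<and> Q \<subseteq> P}"
    then show "compactin X K"
      using UL P by (auto intro!: compactin_Union)
  next
    fix F assume F: "compactin X F"
    have "\<exists>\<V>. finite \<V> \<and> \<V> \<subseteq> U ` P \<and> F \<subseteq> \<Union>\<V>"
      using UL P compactin_subset_topspace[OF F] by (intro compactinD[OF F]) blast+
    then obtain Q where "finite Q" "Q \<subseteq> P" "F \<subseteq> (\<Union>x\<in>Q. U x)"
      by (metis finite_subset_image)
    moreover have "U x \<subseteq> L x" if "x \<in> Q" for x
      using UL P(2) \<open>Q \<subseteq> P\<close> that by blast
    ultimately have "F \<subseteq> (\<Union>x\<in>Q. L x)"
      by (blast intro: subset_trans)
    with \<open>finite Q\<close> \<open>Q \<subseteq> P\<close> show "\<exists>K\<in>(\<lambda>Q. \<Union>x\<in>Q. L x) ` {Q. finite Q \<and> Q \<subseteq> P}. F \<subseteq> K"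
      by blast
  qed
qed


section \<open>Charts of surfaces with boundary\<close>

definition half_plane :: "(real \<times> real) set" where
  "half_plane = UNIV \<times> {0..}"

lemma half_plane_iff [simp]: "z \<in> half_plane \<longleftrightarrow> 0 \<le> snd z"
  by (cases z) (auto simp: half_plane_def)

lemma homeomorphic_half_plane_chart_iff:
  "subtopology S U homeomorphic_space top_of_set ((UNIV :: real set) \<times> {0 :: real ..}) \<longleftrightarrow>
   subtopology S U homeomorphic_space top_of_set half_plane"
  by (simp add: half_plane_def)

lemma convex_half_plane: "convex half_plane" and closed_half_plane: "closed half_plane"
  unfolding half_plane_def by (auto intro!: convex_Times closed_Times)

text \<open>Both model spaces are closed convex subsets of the plane; local properties can be read off
  from this without distinguishing the two kinds of charts.\<close>

lemma surface_with_boundary_convex_chart: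
  assumes "surface_with_boundary S" and "x \<in> topspace S"
  obtains U and H :: "(real \<times> real) set" where "openin S U" "x \<in> U" "convex H" "closed H"
    "subtopology S U homeomorphic_space top_of_set H"
proof -
  obtain U where U: "openin S U" "x \<in> U"
    "subtopology S U homeomorphic_space (euclidean :: (real \<times> real) topology) \<or>
     subtopology S U homeomorphic_space top_of_set half_plane"
    using assms unfolding surface_with_boundary_def homeomorphic_half_plane_chart_iff by blast
  from U(3) show thesis
  proof
    assume "subtopology S U homeomorphic_space (euclidean :: (real \<times> real) topology)"
    with U show thesis
      using that[of U UNIV] by simp
  next
    assume "subtopology S U homeomorphic_space top_of_set half_plane"
    with U show thesis
      using that[of U half_plane] convex_half_plane closed_half_plane by simp
  qed
qed

lemma surface_imp_locally_compact_space:
  assumes "surface_with_boundary S"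
  shows "locally_compact_space S"
  unfolding locally_compact_space_def
proof
  fix x assume "x \<in> topspace S"
  then obtain U and H :: "(real \<times> real) set" where U: "openin S U" "x \<in> U" "closed H"
    and hom: "subtopology S U homeomorphic_space top_of_set H"
    using surface_with_boundary_convex_chart[OF assms] by metis
  have "locally_compact_space (top_of_set H)"
    using U(3) locally_compact_space_closed_subset locally_compact_space_euclidean
    by (metis closed_closedin)
  then have "locally_compact_space (subtopology S U)"
    using hom homeomorphic_locally_compact_space by blast
  then obtain V K where "openin (subtopology S U) V" "compactin (subtopology S U) K" "x \<in> V" "V \<subseteq> K"
    using U openin_subset[OF U(1)] unfolding locally_compact_space_def
    by (metis topspace_subtopology_subset)
  then show "\<exists>V K. openin S V \<and> compactin S K \<and> x \<in> V \<and> V \<subseteq> K"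
    using U(1) by (metis compactin_subtopology openin_trans_full)
qed

lemma surface_imp_locally_connected_space:
  assumes "surface_with_boundary S"
  shows "locally_connected_space S"
  unfolding locally_connected_space
proof (intro allI impI)
  fix V x assume V: "openin S V \<and> x \<in> V"
  then have "x \<in> topspace S"
    using openin_subset by blast
  then obtain U and H :: "(real \<times> real) set" where U: "openin S U" "x \<in> U" "convex H"
    and hom: "subtopology S U homeomorphic_space top_of_set H"
    using surface_with_boundary_convex_chart[OF assms] by metis
  have "locally_connected_space (top_of_set H)"
    using convex_imp_locally_connected[OF U(3)]
    unfolding locally_connected_space locally_connected by (metis connectedin_subtopology connectedin_iff_connected openin_imp_subset)
  then have "locally_connected_space (subtopology S U)"
    using hom homeomorphic_locally_connected_space by blast
  moreover have "openin (subtopology S U) (U \<inter> V)" "x \<in> U \<inter> V"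
    using U V by (auto simp: openin_subtopology)
  ultimately obtain W where "openin (subtopology S U) W" "connectedin (subtopology S U) W"
    "x \<in> W" "W \<subseteq> U \<inter> V"
    unfolding locally_connected_space by metis
  then show "\<exists>W. openin S W \<and> connectedin S W \<and> x \<in> W \<and> W \<subseteq> V"
    using U(1) by (metis connectedin_subtopology le_inf_iff openin_trans_full)
qed

lemma surface_interior_iff:
  "x \<in> surface_interior S \<longleftrightarrow>
     (\<exists>U. openin S U \<and> x \<in> U \<and>
        subtopology S U homeomorphic_space (euclidean :: (real \<times> real) topology))"
  unfolding surface_interior_def surface_boundary_def using openin_subset by fastforce

lemma openin_surface_interior: "openin S (surface_interior S)"
proof (subst openin_subopen, intro ballI)
  fix x assume "x \<in> surface_interior S"
  then obtain U where "openin S U" "x \<in> U"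
    "subtopology S U homeomorphic_space (euclidean :: (real \<times> real) topology)"
    unfolding surface_interior_iff by blast
  then show "\<exists>T. openin S T \<and> x \<in> T \<and> T \<subseteq> surface_interior S"
    by (intro exI[of _ U]) (auto simp: surface_interior_iff)
qed

lemma surface_boundary_subset: "surface_boundary S \<subseteq> topspace S"
  unfolding surface_boundary_def by blast

lemma homeomorphic_imp_homeomorphic_space_top_of_set:
  assumes "A homeomorphic B"
  shows "top_of_set A homeomorphic_space top_of_set B"
proof -
  obtain f g where fg: "homeomorphism A B f g"
    using assms unfolding homeomorphic_def by blast
  then have "homeomorphic_maps (top_of_set A) (top_of_set B) f g"
    unfolding homeomorphic_maps_def homeomorphism_def by (auto simp: continuous_map_in_subtopology)
  then show ?thesis
    unfolding homeomorphic_space_def by blast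
qed

lemma half_plane_chartD:
  assumes U: "openin S U" and fg: "homeomorphic_maps (subtopology S U) (top_of_set half_plane) f g"
  shows "continuous_map (subtopology S U) (top_of_set half_plane) f"
    and "continuous_map (top_of_set half_plane) (subtopology S U) g"
    and "\<And>x. x \<in> U \<Longrightarrow> g (f x) = x" and "\<And>w. w \<in> half_plane \<Longrightarrow> f (g w) = w"
    and "g ` half_plane \<subseteq> U" and "f ` U \<subseteq> half_plane"
proof -
  have top: "topspace (subtopology S U) = U" "topspace (top_of_set half_plane) = half_plane"
    using openin_subset[OF U] by (auto simp del: half_plane_iff)
  show f: "continuous_map (subtopology S U) (top_of_set half_plane) f"
    and g: "continuous_map (top_of_set half_plane) (subtopology S U) g"
    and "\<And>x. x \<in> U \<Longrightarrow> g (f x) = x" and "\<And>w. w \<in> half_plane \<Longrightarrow> f (g w) = w"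
    using fg unfolding homeomorphic_maps_def top by blast+
  show "g ` half_plane \<subseteq> U" "f ` U \<subseteq> half_plane"
    using continuous_map_image_subset_topspace[OF f] continuous_map_image_subset_topspace[OF g]
    unfolding top by blast+
qed

text \<open>The ball around \<open>z\<close> whose radius is the height of \<open>z\<close> stays in the half-plane, and an open ball
  is homeomorphic to the plane.\<close>

lemma open_upper_half_plane_point_interior:
  assumes U: "openin S U" and fg: "homeomorphic_maps (subtopology S U) (top_of_set half_plane) f g"
    and z: "0 < snd z"
  shows "g z \<in> surface_interior S"
proof -
  define B where "B = ball z (snd z)"
  have B: "B \<subseteq> half_plane"
  proof
    fix w assume "w \<in> B"
    then have "dist (snd z) (snd w) < snd z"
      unfolding B_def using dist_snd_le[of z w] by (auto simp: dist_commute)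
    then show "w \<in> half_plane"
      by (auto simp: dist_real_def)
  qed
  have US: "U \<subseteq> topspace S"
    using U openin_subset by blast
  define V where "V = {x \<in> U. f x \<in> B}"
  note f = half_plane_chartD(1)[OF U fg] and fg' = half_plane_chartD(4)[OF U fg]
  have gU: "g w \<in> U" if "w \<in> half_plane" for w
    using half_plane_chartD(5)[OF U fg] that by blast
  have "openin (top_of_set half_plane) B"
    using B unfolding B_def by (simp add: open_subset)
  then have "openin (subtopology S U) V"
    using openin_continuous_map_preimage[OF f] US unfolding V_def by (simp add: Int_absorb1)
  then have V: "openin S V"
    using U openin_trans_full by blast
  have "homeomorphic_maps (subtopology (subtopology S U) V) (subtopology (top_of_set half_plane) B) f g"
    using fg by (rule homeomorphic_maps_subtopologies_alt) (use B gU fg' in \<open>auto simp: V_def\<close>)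
  moreover have "U \<inter> V = V" "half_plane \<inter> B = B"
    using B by (auto simp: V_def)
  ultimately have "homeomorphic_maps (subtopology S V) (top_of_set B) f g"
    by (simp add: subtopology_subtopology)
  then have "subtopology S V homeomorphic_space top_of_set B"
    unfolding homeomorphic_space_def by blast
  also have "top_of_set B homeomorphic_space (euclidean :: (real \<times> real) topology)"
    using homeomorphic_imp_homeomorphic_space_top_of_set[OF homeomorphic_ball_UNIV[OF z, of z]]
    unfolding B_def by simp
  finally have "subtopology S V homeomorphic_space (euclidean :: (real \<times> real) topology)" .
  moreover have "g z \<in> V"
    using z gU fg' unfolding V_def B_def by auto
  ultimately show ?thesis
    using V unfolding surface_interior_iff by blast
qed

text \<open>If the image of an edge point \<open>z\<close> also had a planar chart, the change of charts would be a
  continuous injection of an open set of the plane into the half-plane with \<open>z\<close> in its image. By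
  invariance of domain its image is open in the plane, so it contains points below the edge.\<close>

lemma half_plane_edge_point_boundary:
  assumes U: "openin S U" and fg: "homeomorphic_maps (subtopology S U) (top_of_set half_plane) f g"
    and z: "snd z = 0"
  shows "g z \<in> surface_boundary S"
proof (rule ccontr)
  assume "g z \<notin> surface_boundary S"
  have US: "U \<subseteq> topspace S"
    using U openin_subset by blast
  note f = half_plane_chartD(1)[OF U fg] and gf = half_plane_chartD(3)[OF U fg]
    and fg' = half_plane_chartD(4)[OF U fg]
  have "z \<in> half_plane"
    using z by simp
  then have gz: "g z \<in> U"
    using half_plane_chartD(5)[OF U fg] by blast
  with \<open>g z \<notin> surface_boundary S\<close> have "g z \<in> surface_interior S"
    using US unfolding surface_interior_def by blast
  then obtain V h k where V: "openin S V" "g z \<in> V"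
    and hk: "homeomorphic_maps (subtopology S V) (euclidean :: (real \<times> real) topology) h k"
    unfolding surface_interior_iff homeomorphic_space_def by blast
  have VS: "V \<subseteq> topspace S"
    using V openin_subset by blast
  have k: "continuous_map euclidean (subtopology S V) k"
    and kh: "\<And>x. x \<in> V \<Longrightarrow> k (h x) = x" and hk': "\<And>w. h (k w) = w"
    using hk VS unfolding homeomorphic_maps_def by auto
  define W where "W = {w. k w \<in> U}"
  have kS: "continuous_map euclidean S k"
    using k continuous_map_into_fulltopology by blast
  have "openin euclidean {w \<in> topspace euclidean. k w \<in> U}"
    using openin_continuous_map_preimage[OF kS U] .
  then have "open W"
    unfolding W_def by simp
  have "continuous_map (top_of_set W) (subtopology S U) k"
    using kS unfolding continuous_map_in_subtopology W_def
    by (auto intro: continuous_map_from_subtopology)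
  then have fk: "continuous_map (top_of_set W) (top_of_set half_plane) (f \<circ> k)"
    using f continuous_map_compose by blast
  then have "continuous_on W (f \<circ> k)"
    by (simp add: continuous_map_in_subtopology)
  moreover have "inj_on (f \<circ> k) W"
    unfolding W_def by (intro inj_on_inverseI[of _ "h \<circ> g"]) (simp add: gf hk')
  ultimately have "open ((f \<circ> k) ` W)"
    using \<open>open W\<close> invariance_of_domain by blast
  moreover have "z \<in> (f \<circ> k) ` W"
    using V gz z by (intro image_eqI[of _ _ "h (g z)"]) (auto simp: W_def kh fg')
  ultimately obtain e where e: "e > 0" "ball z e \<subseteq> (f \<circ> k) ` W"
    using open_contains_ball by blast
  \<comment> \<open>A point just below \<open>z\<close>, outside the half-plane.\<close>
  have "(fst z, - e/2) \<in> ball z e"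
    using e z by (cases z) (auto simp: dist_Pair_Pair dist_real_def)
  moreover have "(f \<circ> k) ` W \<subseteq> half_plane"
    using continuous_map_image_subset_topspace[OF fk] by simp
  ultimately have "(fst z, - e/2) \<in> half_plane"
    using e(2) by (meson subsetD)
  with e show False
    by simp
qed

text \<open>A half-plane chart carries the edge onto the boundary part of its domain and the open
  half-plane onto the interior part, and every edge point is a limit of the open half-plane.\<close>

lemma surface_boundary_chart:
  assumes S: "surface_with_boundary S" and p: "p \<in> surface_boundary S"
  obtains U where "openin S U" "p \<in> U" "connectedin S (U \<inter> surface_boundary S)"
    "connectedin S (U \<inter> surface_interior S)" "U \<subseteq> S closure_of (U \<inter> surface_interior S)"
proof -
  have "p \<in> topspace S"
    using p surface_boundary_subset by (rule set_rev_mp)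
  then obtain U where U: "openin S U" "p \<in> U" "subtopology S U homeomorphic_space top_of_set half_plane"
    using S p unfolding surface_with_boundary_def homeomorphic_half_plane_chart_iff
      surface_boundary_def by blast
  then obtain f g where fg: "homeomorphic_maps (subtopology S U) (top_of_set half_plane) f g"
    unfolding homeomorphic_space_def by blast
  have US: "U \<subseteq> topspace S"
    using U openin_subset by blast
  note g = half_plane_chartD(2)[OF U(1) fg] and gf = half_plane_chartD(3)[OF U(1) fg]
    and gU = half_plane_chartD(5)[OF U(1) fg] and fU = half_plane_chartD(6)[OF U(1) fg]
  have gS: "continuous_map (top_of_set half_plane) S g"
    using g continuous_map_into_fulltopology by blast
  define L where "L = {z :: real \<times> real. snd z = 0}"
  define P where "P = {z :: real \<times> real. 0 < snd z}"
  have gL: "g z \<in> surface_boundary S" if "z \<in> L" for z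
    using half_plane_edge_point_boundary[OF U(1) fg] that unfolding L_def by blast
  have gP: "g z \<in> surface_interior S" if "z \<in> P" for z
    using open_upper_half_plane_point_interior[OF U(1) fg] that unfolding P_def by blast
  have LP: "half_plane = L \<union> P"
    unfolding L_def P_def by auto
  have bd: "U \<inter> surface_boundary S = g ` L"
  proof
    show "U \<inter> surface_boundary S \<subseteq> g ` L"
    proof
      fix x assume x: "x \<in> U \<inter> surface_boundary S"
      then have "f x \<in> half_plane" "g (f x) = x"
        using fU gf by blast+
      with x gP[of "f x"] show "x \<in> g ` L"
        unfolding LP surface_interior_def by force
    qed
  qed (use gL gU LP in blast)
  have int: "U \<inter> surface_interior S = g ` P"
  proof
    show "U \<inter> surface_interior S \<subseteq> g ` P"
    proof
      fix x assume x: "x \<in> U \<inter> surface_interior S"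
      then have "f x \<in> half_plane" "g (f x) = x"
        using fU gf by blast+
      with x gL[of "f x"] show "x \<in> g ` P"
        unfolding LP surface_interior_def by force
    qed
  qed (use gP gU LP in blast)
  have "L = UNIV \<times> {0}" "P = UNIV \<times> {0<..}"
    unfolding L_def P_def by auto
  then have "convex L" "convex P"
    by (auto intro!: convex_Times)
  then have "connectedin (top_of_set half_plane) L" "connectedin (top_of_set half_plane) P"
    by (auto simp: connectedin_subtopology LP convex_connected)
  then have "connectedin S (U \<inter> surface_boundary S)" "connectedin S (U \<inter> surface_interior S)"
    unfolding bd int using gS connectedin_continuous_map_image by blast+
  moreover have "U \<subseteq> S closure_of (U \<inter> surface_interior S)"
  proof -
    have "L \<subseteq> closure P"
    proof
      fix z assume z: "z \<in> L"
      show "z \<in> closure P"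
        unfolding closure_approachable
      proof (intro allI impI)
        fix e :: real assume "e > 0"
        with z show "\<exists>y\<in>P. dist y z < e"
          by (intro bexI[of _ "(fst z, e/2)"], cases z) (auto simp: L_def P_def dist_Pair_Pair dist_real_def)
      qed
    qed
    then have "half_plane \<subseteq> top_of_set half_plane closure_of P"
      using closure_subset[of P] unfolding closure_of_subtopology LP by (auto simp: closure_of_subtopology Int_absorb1)
    then have "g ` half_plane \<subseteq> S closure_of (g ` P)"
      using gS unfolding continuous_map_eq_image_closure_subset by blast
    moreover have "U \<subseteq> g ` half_plane"
      using gf fU by force
    ultimately show ?thesis
      unfolding int by blast
  qed
  ultimately show thesis
    using that U by blast
qed

section \<open>The interior and the boundary components\<close>

lemma closure_of_surface_interior:
  assumes "surface_with_boundary S"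
  shows "S closure_of surface_interior S = topspace S"
proof (intro equalityI closure_of_subset_topspace subsetI)
  fix x assume x: "x \<in> topspace S"
  show "x \<in> S closure_of surface_interior S"
  proof (cases "x \<in> surface_boundary S")
    case True
    then obtain U where "x \<in> U" "U \<subseteq> S closure_of (U \<inter> surface_interior S)"
      using surface_boundary_chart[OF assms] by metis
    then show ?thesis
      using closure_of_mono[of "U \<inter> surface_interior S" "surface_interior S" S] by blast
  next
    case False
    with x have "x \<in> surface_interior S"
      unfolding surface_interior_def by blast
    then show ?thesis
      using closure_of_subset[OF openin_subset[OF openin_surface_interior], of S] by (rule subsetD[rotated])
  qed
qed

text \<open>If \<open>A\<close> and \<open>B\<close> disconnected the dense interior, their closures would cover \<open>S\<close> and hence meet.
  A common point is on the boundary, and the interior part of a half-plane chart around it would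
  be a connected set that meets both \<open>A\<close> and \<open>B\<close>.\<close>

lemma connectedin_surface_interior:
  assumes S: "surface_with_boundary S" and conn: "connected_space S"
  shows "connectedin S (surface_interior S)"
proof (rule ccontr)
  let ?M = "surface_interior S"
  have M: "?M \<subseteq> topspace S"
    by (rule openin_subset[OF openin_surface_interior])
  assume "\<not> connectedin S ?M"
  then obtain A B where AB: "openin (subtopology S ?M) A" "openin (subtopology S ?M) B"
    "A \<union> B = ?M" "A \<inter> B = {}" "A \<noteq> {}" "B \<noteq> {}"
    using M unfolding connectedin_def connected_space_eq topspace_subtopology_subset[OF M] by blast
  then have oA: "openin S A" and oB: "openin S B"
    using openin_trans_full[OF _ openin_surface_interior] by blast+
  have "S closure_of A \<union> S closure_of B = topspace S"
    using AB(3) closure_of_surface_interior[OF S] closure_of_Un by metis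
  moreover have "S closure_of A \<noteq> {}" "S closure_of B \<noteq> {}"
    using AB oA oB openin_subset closure_of_subset by (metis subset_empty)+
  ultimately have "S closure_of A \<inter> S closure_of B \<noteq> {}"
    using conn unfolding connected_space_closedin_eq by (meson closedin_closure_of)
  then obtain p where p: "p \<in> S closure_of A" "p \<in> S closure_of B"
    by blast
  have meets: "T \<inter> A \<noteq> {}" "T \<inter> B \<noteq> {}" if "openin S T" "p \<in> T" for T
    using p that unfolding in_closure_of by blast+
  have "p \<notin> ?M"
    using meets[OF oA] meets[OF oB] AB by blast
  moreover have "p \<in> topspace S"
    using p closure_of_subset_topspace by fastforce
  ultimately have "p \<in> surface_boundary S"
    unfolding surface_interior_def by blast
  then obtain U where U: "openin S U" "p \<in> U" "connectedin S (U \<inter> ?M)"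
    using surface_boundary_chart[OF S] by metis
  have "A \<inter> (U \<inter> ?M) \<noteq> {}" "B \<inter> (U \<inter> ?M) \<noteq> {}"
    using meets[OF U(1,2)] AB(3) by blast+
  moreover have "U \<inter> ?M \<subseteq> A \<union> B" "A \<inter> B \<inter> (U \<inter> ?M) = {}"
    using AB by blast+
  ultimately show False
    using U(3) oA oB unfolding connectedin by blast
qed

lemma openin_component_of_surface_boundary:
  assumes S: "surface_with_boundary S"
    and C: "C \<in> connected_components_of (subtopology S (surface_boundary S))"
  shows "openin (subtopology S (surface_boundary S)) C"
proof (subst openin_subopen, intro ballI)
  let ?X = "subtopology S (surface_boundary S)"
  fix p assume p: "p \<in> C"
  have "p \<in> surface_boundary S"
    using p connected_components_of_subset[OF C] by auto
  then obtain U where U: "openin S U" "p \<in> U" "connectedin S (U \<inter> surface_boundary S)"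
    using surface_boundary_chart[OF S] by metis
  have "connectedin ?X (U \<inter> surface_boundary S)"
    using U by (simp add: connectedin_subtopology)
  then have "U \<inter> surface_boundary S \<subseteq> C"
    using connected_components_of_maximal[OF C] p U \<open>p \<in> surface_boundary S\<close>
    by (meson IntI disjnt_iff)
  moreover have "openin ?X (U \<inter> surface_boundary S)"
    using U(1) by (auto simp: openin_subtopology)
  ultimately show "\<exists>T. openin ?X T \<and> p \<in> T \<and> T \<subseteq> C"
    using U \<open>p \<in> surface_boundary S\<close> by blast
qed

text \<open>\<open>F\<close> is the rim of a compact neighborhood \<open>K\<close> of \<open>C\<close> that avoids the rest of the boundary, that
  is, \<open>K\<close> minus an open set \<open>W\<close> with \<open>C \<subseteq> W \<subseteq> K\<close>. Off the rim, membership in \<open>K\<close> is an open and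
  closed condition, so a connected set through \<open>C\<close> that avoids \<open>F\<close> is trapped in \<open>K\<close>.\<close>

lemma compact_boundary_component_cut_off:
  assumes S: "surface_with_boundary S"
    and C: "C \<in> connected_components_of (subtopology S (surface_boundary S))" and "compactin S C"
  obtains F where "compactin S F" "F \<subseteq> surface_interior S"
    "\<And>E. \<lbrakk>connectedin S E; C \<subseteq> E; E \<inter> F = {}\<rbrakk> \<Longrightarrow> E \<inter> surface_boundary S = C"
proof -
  let ?B = "surface_boundary S"
  have haus: "Hausdorff_space S"
    using S unfolding surface_with_boundary_def by blast
  obtain G where G: "openin S G" "C = G \<inter> ?B"
    using openin_component_of_surface_boundary[OF S C] unfolding openin_subtopology by blast
  have nb: "neighbourhood_base_of (\<lambda>K. compactin S K \<and> closedin S K) S"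
    using locally_compact_space_neighbourhood_base_closedin surface_imp_locally_compact_space[OF S] haus
    by blast
  have "\<exists>V L. openin S V \<and> compactin S L \<and> closedin S L \<and> x \<in> V \<and> V \<subseteq> L \<and> L \<subseteq> G"
    if "x \<in> C" for x
    using nb[unfolded neighbourhood_base_of, rule_format, of G x] G that by auto
  then obtain V L where VL: "\<And>x. x \<in> C \<Longrightarrow> openin S (V x) \<and> compactin S (L x) \<and> closedin S (L x)
      \<and> x \<in> V x \<and> V x \<subseteq> L x \<and> L x \<subseteq> G"
    by metis
  have "\<exists>\<V>. finite \<V> \<and> \<V> \<subseteq> V ` C \<and> C \<subseteq> \<Union>\<V>"
    using VL by (intro compactinD[OF \<open>compactin S C\<close>]) blast+
  then obtain Q where Q: "finite Q" "Q \<subseteq> C" "C \<subseteq> (\<Union>x\<in>Q. V x)"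
    by (metis finite_subset_image)
  define W where "W = (\<Union>x\<in>Q. V x)"
  define K where "K = (\<Union>x\<in>Q. L x)"
  have W: "openin S W" "C \<subseteq> W" "W \<subseteq> K"
    using VL Q unfolding W_def K_def by blast+
  have K: "compactin S K" "closedin S K" "K \<subseteq> G"
    using VL Q unfolding K_def by (auto intro!: compactin_Union closedin_Union)
  show thesis
  proof
    have "closedin S (K - W)"
      using K W by (simp add: closedin_diff)
    then show "compactin S (K - W)"
      using K(1) closed_compactin by blast
    show "K - W \<subseteq> surface_interior S"
      using K W G compactin_subset_topspace[OF K(1)] unfolding surface_interior_def by blast
  next
    fix E assume E: "connectedin S E" "C \<subseteq> E" "E \<inter> (K - W) = {}"
    have "C \<noteq> {}"
      using nonempty_connected_components_of[OF C] .
    have "E \<subseteq> topspace S"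
      using E connectedin_subset_topspace by blast
    have "openin S (topspace S - K)"
      using K by blast
    moreover have "E \<subseteq> W \<union> (topspace S - K)" "W \<inter> (topspace S - K) \<inter> E = {}" "W \<inter> E \<noteq> {}"
      using E W \<open>C \<noteq> {}\<close> \<open>E \<subseteq> topspace S\<close> by blast+
    ultimately have "(topspace S - K) \<inter> E = {}"
      using E(1) W(1) unfolding connectedin by blast
    then have "E \<subseteq> G"
      using \<open>E \<subseteq> topspace S\<close> K by blast
    then show "E \<inter> ?B = C"
      using G E by blast
  qed
qed

section \<open>Countably many compact boundary components\<close>

text \<open>A compact component \<open>C\<close> is encoded by a compact \<open>K\<close> from a countable family that contains its
  rim and by a point \<open>d\<close> of a countable dense set on the same side of \<open>K\<close> as \<open>C\<close>: the component
  of \<open>d\<close> in the complement of \<open>K\<close> meets the boundary exactly in \<open>C\<close>.\<close>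

theorem countable_compact_boundary_components:
  assumes S: "surface_with_boundary S" and "connected_space S"
    and "metrizable_space (subtopology S (surface_interior S))"
  shows "countable {C \<in> connected_components_of (subtopology S (surface_boundary S)). compactin S C}"
proof -
  let ?B = "surface_boundary S" and ?M = "surface_interior S"
  have haus: "Hausdorff_space S"
    using S unfolding surface_with_boundary_def by blast
  have loc: "locally_compact_space (subtopology S ?M)"
    using haus surface_imp_locally_compact_space[OF S] openin_surface_interior
    by (intro locally_compact_space_open_subset) auto
  have "connected_space (subtopology S ?M)"
    using connectedin_surface_interior[OF S] assms unfolding connectedin_def by blast
  with loc have sc: "second_countable (subtopology S ?M)"
    using assms connected_locally_compact_metrizable_imp_second_countable by blast
  have MS: "?M \<subseteq> topspace S"
    by (rule openin_subset[OF openin_surface_interior])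
  obtain D where D: "countable D" "D \<subseteq> ?M" "(subtopology S ?M) closure_of D = ?M"
    using second_countable_imp_separable_space[OF sc] MS unfolding separable_space_def
    by (auto simp: Int_absorb1)
  obtain \<K> where \<K>: "countable \<K>" "\<And>K. K \<in> \<K> \<Longrightarrow> compactin (subtopology S ?M) K"
    "\<And>F. compactin (subtopology S ?M) F \<Longrightarrow> \<exists>K\<in>\<K>. F \<subseteq> K"
    using Lindelof_locally_compact_imp_hemicompact[OF second_countable_imp_Lindelof_space[OF sc] loc]
    by blast
  let ?E = "\<lambda>K. connected_component_of_set (subtopology S (topspace S - K))"
  have "C \<in> (\<lambda>(K,d). ?E K d \<inter> ?B) ` (\<K> \<times> D)"
    if C: "C \<in> connected_components_of (subtopology S ?B)" and "compactin S C" for C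
  proof -
    obtain F where F: "compactin S F" "F \<subseteq> ?M"
      and cut: "\<And>E. \<lbrakk>connectedin S E; C \<subseteq> E; E \<inter> F = {}\<rbrakk> \<Longrightarrow> E \<inter> ?B = C"
      using compact_boundary_component_cut_off[OF S C \<open>compactin S C\<close>] by blast
    then obtain K where K: "K \<in> \<K>" "F \<subseteq> K"
      using \<K>(3)[of F] unfolding compactin_subtopology by blast
    then have KM: "compactin S K" "K \<subseteq> ?M"
      using \<K>(2) by (auto simp: compactin_subtopology)
    have op: "openin S (topspace S - K)"
      using KM haus compactin_imp_closedin by blast
    have CB: "C \<subseteq> ?B"
      using connected_components_of_subset[OF C] by auto
    then have CK: "C \<subseteq> topspace S - K"
      using KM surface_boundary_subset[of S] unfolding surface_interior_def by blast
    \<comment> \<open>The component is first taken around a point of \<open>C\<close>; density of the interior and of \<open>D\<close> then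
      lets a point of \<open>D\<close> replace it.\<close>
    obtain c where c: "c \<in> C"
      using nonempty_connected_components_of[OF C] by auto
    have "connectedin (subtopology S (topspace S - K)) C"
      using connectedin_connected_components_of[OF C] CK by (simp add: connectedin_subtopology)
    then have CE: "C \<subseteq> ?E K c"
      using c connected_component_of_maximal by fastforce
    have conE: "connectedin S (?E K c)" and EK: "?E K c \<subseteq> topspace S - K"
      using connectedin_connected_component_of[of "subtopology S (topspace S - K)" c]
      by (auto simp: connectedin_subtopology)
    have "locally_connected_space S"
      using surface_imp_locally_connected_space[OF S] .
    then have opE: "openin S (?E K c)"
      using op c CK unfolding locally_connected_space_eq_open_connected_component_of by blast
    have "c \<in> S closure_of ?M"
      using closure_of_surface_interior[OF S] CK c by blast
    then obtain y where y: "y \<in> ?M" "y \<in> ?E K c"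
      using opE CE c unfolding in_closure_of by blast
    moreover have "openin (subtopology S ?M) (?E K c \<inter> ?M)"
      using opE by (auto simp: openin_subtopology)
    ultimately have "(?E K c \<inter> ?M) \<inter> D \<noteq> {}"
      using D(3) openin_Int_closure_of_eq_empty[of "subtopology S ?M" "?E K c \<inter> ?M" D] by auto
    then obtain d where d: "d \<in> D" "d \<in> ?E K c"
      by blast
    from d(2) have "connected_component_of (subtopology S (topspace S - K)) c
        = connected_component_of (subtopology S (topspace S - K)) d"
      by (subst (asm) mem_Collect_eq, subst (asm) connected_component_of_equiv) blast
    then have "?E K d = ?E K c"
      by simp
    moreover have "?E K c \<inter> ?B = C"
      using cut[OF conE CE] EK K by blast
    ultimately show ?thesis
      using K d by (intro image_eqI[of _ _ "(K,d)"]) auto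
  qed
  then have "{C \<in> connected_components_of (subtopology S ?B). compactin S C}
      \<subseteq> (\<lambda>(K,d). ?E K d \<inter> ?B) ` (\<K> \<times> D)"
    by blast
  then show ?thesis
    using \<K>(1) D(1) by (meson countable_SIGMA countable_image countable_subset)
qed

theorem proposition2:
  fixes S :: "'a topology"
  assumes "surface_with_boundary S"
    and "connected_space S"
    and "metrizable_space (subtopology S (surface_interior S))"
  shows "countable {C \<in> connected_components_of (subtopology S (surface_boundary S)).
           subtopology S C homeomorphic_space top_of_set (sphere (0 :: real \<times> real) 1)}"
proof (rule countable_subset[OF _ countable_compact_boundary_components[OF assms]])
  let ?B = "subtopology S (surface_boundary S)"
  have "compactin S C" if C: "C \<in> connected_components_of ?B"
    and hom: "subtopology S C homeomorphic_space top_of_set (sphere (0 :: real \<times> real) 1)" for C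
  proof -
    have "compact_space (subtopology S C)"
      using homeomorphic_compact_space[OF hom] by (simp add: compact_space_subtopology)
    moreover have "C \<subseteq> topspace S"
      using connected_components_of_subset[OF C] by auto
    ultimately show ?thesis
      by (simp add: compactin_subspace)
  qed
  then show "{C \<in> connected_components_of ?B.
      subtopology S C homeomorphic_space top_of_set (sphere (0 :: real \<times> real) 1)}
    \<subseteq> {C \<in> connected_components_of ?B. compactin S C}"
    by blast
qed

end
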